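(* Let $k\in\mathbb{N}$ and let $\mathbf{b}=(b_1,b_2,\ldots,b_k)\in\mathbb{N}^k$ satisfy $\gcd(b_1,b_2,\ldots,b_k)=1$. Then the proportion of points $\mathbf{n}\in\mathbb{N}^k$ that are $\mathbf{b}$-visible is $\dfrac{1}{\zeta\left(\sum_{i=1}^{k}b_i\right)}$; that is, $$\lim_{N\to\infty}\frac{\#\{\mathbf{n}\in\{1,\ldots,N\}^k : \mathbf{n}\text{ is }\mathbf{b}\text{-visible}\}}{N^k}=\frac{1}{\zeta\left(\sum_{i=1}^{k}b_i\right)}.$$
   Context: $\mathbb{N}=\{1,2,3,\ldots\}$ is the set of positive integers, and $\zeta(s)=\sum_{n=1}^{\infty}n^{-s}$ is the Riemann zeta function, with the convention $1/\zeta(1)=0$. For $\mathbf{b}=(b_1,\ldots,b_k)\in\mathbb{N}^k$, a lattice point $\mathbf{n}=(n_1,\ldots,n_k)\in\mathbb{N}^k$ is called $\mathbf{b}$-visible if there does not exist a real number $t$ with $0<t<1$ such that $(n_1t^{b_1},n_2t^{b_2},\ldots,n_kt^{b_k})\in\mathbb{N}^k$. *)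

theory Defs
  imports Complex_Main "HOL-Library.FuncSet"
begin

text \<open>Points of \<open>\<nat>^k\<close> are functions \<open>nat \<Rightarrow> nat\<close>, of which only the values on \<open>{1..k}\<close> matter.
  They are extensional wherever they are counted.\<close>

definition visible :: "nat \<Rightarrow> (nat \<Rightarrow> nat) \<Rightarrow> (nat \<Rightarrow> nat) \<Rightarrow> bool" where
  "visible k b n \<longleftrightarrow>
     \<not> (\<exists>t::real. 0 < t \<and> t < 1 \<and> (\<forall>i\<in>{1..k}. real (n i) * t ^ b i \<in> real ` {1..}))"

text \<open>Meaningful only for \<open>s > 1\<close>, where the series converges.\<close>

definition zeta :: "real \<Rightarrow> real" where
  "zeta s = (\<Sum>n. real (Suc n) powr (- s))"

text \<open>The reciprocal of \<open>zeta\<close>, with the convention \<open>1 / \<zeta>(1) = 0\<close>.\<close>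

definition inverse_zeta :: "real \<Rightarrow> real" where
  "inverse_zeta s = (if s = 1 then 0 else 1 / zeta s)"

end

theory Submission
  imports Defs "HOL-Analysis.Uniform_Limit" "HOL-Analysis.Infinite_Sum"
    "HOL-Computational_Algebra.Squarefree"
begin

text \<open>Bezout's identity applied to the exponents \<open>b\<^sub>i\<close> makes every admissible \<open>t\<close> rational, so \<open>n\<close> is
  invisible iff some \<open>d \<ge> 2\<close> satisfies \<open>d ^ b\<^sub>i dvd n\<^sub>i\<close> for all \<open>i\<close>. The set of all \<open>d\<close> with this
  divisibility property consists of the divisors of a single number, hence Moebius inversion counts
  the visible points of the box as \<open>\<Sum>d. \<mu>(d) \<Prod>i. \<lfloor>N / d ^ b\<^sub>i\<rfloor>\<close>. Dividing by \<open>N ^ k\<close>, the terms are dominated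
  by \<open>1 / d ^ s\<close> with \<open>s = \<Sum>i. b\<^sub>i\<close>, and for \<open>s \<ge> 2\<close> Tannery's theorem gives the limit
  \<open>\<Sum>d. \<mu>(d) / d ^ s = 1 / \<zeta>(s)\<close>. If \<open>s = 1\<close>, then \<open>k = 1\<close> and only the point \<open>1\<close> is visible.\<close>

section \<open>The Moebius function and its divisor sums\<close>

definition moebius :: "nat \<Rightarrow> real" where
  "moebius n = (if squarefree n then (-1) ^ card (prime_factors n) else 0)"

lemma moebius_1 [simp]: "moebius (Suc 0) = 1"
  using squarefree_1[where 'a = nat] by (simp add: moebius_def)

lemma abs_moebius_le: "\<bar>moebius n\<bar> \<le> 1"
  by (simp add: moebius_def)

text \<open>The new prime adds one to the number of prime factors and does not affect
  squarefreeness, so only the sign changes.\<close>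

lemma moebius_prime_mult:
  assumes "prime p" "\<not> p dvd n"
  shows "moebius (p * n) = - moebius n"
proof -
  have n: "n \<noteq> 0" using assms(2) by (intro notI) simp
  have cop: "coprime p n" using assms by (simp add: prime_imp_coprime)
  have "prime_factors (p * n) = insert p (prime_factors n)"
    using assms n by (simp add: prime_factors_product prime_prime_factors prime_gt_0_nat)
  moreover have "p \<notin> prime_factors n" using assms(2) by auto
  ultimately have "card (prime_factors (p * n)) = Suc (card (prime_factors n))"
    by simp
  moreover have "squarefree (p * n) \<longleftrightarrow> squarefree n"
    using squarefree_mult_coprime[OF cop squarefree_prime[OF assms(1)]] squarefree_multD(2)
    by blast
  ultimately show ?thesis by (simp add: moebius_def)
qed

text \<open>For \<open>n > 1\<close> fix a prime \<open>p\<close> dividing \<open>n\<close>. Only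
  squarefree divisors contribute, and multiplication by \<open>p\<close> pairs those prime to
  \<open>p\<close> with those divisible by \<open>p\<close>; the two members of a pair have opposite
  signs.\<close>

lemma sum_moebius_divisors:
  assumes "n > 0"
  shows "(\<Sum>d | d dvd n. moebius d) = (if n = 1 then 1 else 0)"
proof (cases "n = 1")
  case False
  then obtain p where p: "prime p" "p dvd n"
    using prime_factor_nat by blast
  have fin: "finite {d. d dvd n}" using assms by simp
  have "(\<Sum>d | d dvd n \<and> squarefree d \<and> p dvd d. moebius d)
      = (\<Sum>d | d dvd n \<and> squarefree d \<and> \<not> p dvd d. - moebius d)"
  proof (rule sum.reindex_bij_witness[of _ "\<lambda>d. p * d" "\<lambda>d. d div p"])
    fix d assume "d \<in> {d. d dvd n \<and> squarefree d \<and> p dvd d}"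
    then have d: "d dvd n" "squarefree d" "p dvd d" by auto
    then obtain e where e: "d = p * e" by blast
    have ne: "\<not> p dvd e"
    proof
      assume "p dvd e"
      then have "p ^ 2 dvd d" by (simp add: e power2_eq_square)
      then show False using squarefreeD[OF d(2)] p(1) not_prime_unit by blast
    qed
    show "p * (d div p) = d" using d(3) by simp
    show "d div p \<in> {d. d dvd n \<and> squarefree d \<and> \<not> p dvd d}"
      using d e ne p(1) squarefree_multD(2)[of p e] by (auto simp: prime_gt_0_nat dest: dvd_mult_right)
    show "- moebius (d div p) = moebius d"
      using moebius_prime_mult[OF p(1) ne] e p(1) by (simp add: prime_gt_0_nat)
  next
    fix d assume "d \<in> {d. d dvd n \<and> squarefree d \<and> \<not> p dvd d}"
    then have d: "d dvd n" "squarefree d" "\<not> p dvd d" by auto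
    have cop: "coprime p d" using d(3) p(1) by (simp add: prime_imp_coprime)
    show "p * d div p = d" using p(1) by (simp add: prime_gt_0_nat)
    show "p * d \<in> {d. d dvd n \<and> squarefree d \<and> p dvd d}"
      using divides_mult[OF p(2) d(1) cop] squarefree_mult_coprime[OF cop squarefree_prime[OF p(1)] d(2)]
      by simp
  qed
  moreover have "(\<Sum>d | d dvd n. moebius d) = (\<Sum>d | d dvd n \<and> squarefree d. moebius d)"
    using fin by (intro sum.mono_neutral_right) (auto simp: moebius_def)
  moreover have "(\<Sum>d | d dvd n \<and> squarefree d. moebius d)
     = (\<Sum>d | d dvd n \<and> squarefree d \<and> p dvd d. moebius d)
       + (\<Sum>d | d dvd n \<and> squarefree d \<and> \<not> p dvd d. moebius d)"
    using fin by (subst sum.union_disjoint[symmetric]) (auto intro!: sum.cong)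
  ultimately show ?thesis using False by (simp add: sum_negf)
qed (simp)

section \<open>Detecting common power divisors by Moebius sums\<close>

text \<open>The lcm of any element with the maximum lies in \<open>S\<close> again, so it cannot
  exceed the maximum and must equal it.\<close>

lemma divisor_closed_set_eq_divisors:
  fixes S :: "nat set"
  assumes "finite S" "S \<noteq> {}" "0 \<notin> S"
    and dvd: "\<And>d e. e \<in> S \<Longrightarrow> d dvd e \<Longrightarrow> d \<in> S"
    and lcm: "\<And>d e. d \<in> S \<Longrightarrow> e \<in> S \<Longrightarrow> lcm d e \<in> S"
  shows "S = {d. d dvd Max S}"
proof
  show "S \<subseteq> {d. d dvd Max S}"
  proof
    fix d assume d: "d \<in> S"
    have M: "Max S \<in> S" using assms by simp
    have "lcm d (Max S) \<le> Max S" using assms(1) lcm[OF d M] by simp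
    moreover have "Max S \<le> lcm d (Max S)"
      using lcm[OF d M] assms(3) by (intro dvd_imp_le) (auto intro: gr0I)
    ultimately have "lcm d (Max S) = Max S" by simp
    then show "d \<in> {d. d dvd Max S}" by (metis dvd_lcm1 mem_Collect_eq)
  qed
  show "{d. d dvd Max S} \<subseteq> S" using assms(1,2) by (auto intro: dvd[OF Max_in])
qed

lemma lcm_power_dvd:
  fixes d e n :: nat
  assumes "d ^ c dvd n" "e ^ c dvd n"
  shows "lcm d e ^ c dvd n"
proof (cases "d = 0")
  case True
  then show ?thesis using assms by simp
next
  case False
  have "lcm d e ^ c * gcd d e ^ c = lcm (d ^ c) (e ^ c) * gcd (d ^ c) (e ^ c)"
    by (metis mult.commute power_mult_distrib prod_gcd_lcm_nat)
  \<comment> \<open>The gcd factor, nonzero because \<open>d\<close> is, cancels.\<close>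
  then have "lcm d e ^ c = lcm (d ^ c) (e ^ c)"
    using False by (simp add: gcd_exp)
  then show ?thesis using assms by simp
qed

text \<open>The admissible \<open>d\<close> are the divisors of a single number, their maximum, so
  the Moebius sum over them tests whether this number is 1.\<close>

lemma sum_moebius_power_dvd:
  assumes "I \<noteq> {}" "\<And>i. i \<in> I \<Longrightarrow> b i \<ge> 1" "\<And>i. i \<in> I \<Longrightarrow> n i \<in> {1..N}"
  shows "(\<Sum>d | d \<in> {1..N} \<and> (\<forall>i\<in>I. d ^ b i dvd n i). moebius d)
         = (if \<forall>d. (\<forall>i\<in>I. d ^ b i dvd n i) \<longrightarrow> d = 1 then 1 else 0)"
proof -
  define S where "S = {d. \<forall>i\<in>I. d ^ b i dvd n i}"
  obtain i where i: "i \<in> I" using assms(1) by blast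
  have pos: "0 \<notin> S"
    using i assms(2)[OF i] assms(3)[OF i] by (auto simp: S_def zero_power intro!: bexI[of _ i])
  \<comment> \<open>Truncating at \<open>N\<close> loses no admissible \<open>d\<close>: since
    \<open>b i \<ge> 1\<close>, \<open>d\<close> itself divides \<open>n i\<close>, which is at most
    \<open>N\<close>.\<close>
  have S_le: "d \<in> {1..N}" if "d \<in> S" for d
  proof -
    have "d dvd d ^ b i" using assms(2)[OF i] by (simp add: dvd_power)
    also have "\<dots> dvd n i" using that i by (simp add: S_def)
    finally have "d \<le> n i" using assms(3)[OF i] by (intro dvd_imp_le) auto
    then show ?thesis using assms(3)[OF i] that pos by (cases "d = 0") auto
  qed
  have S_eq: "{d \<in> {1..N}. \<forall>i\<in>I. d ^ b i dvd n i} = S"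
    using S_le by (auto simp: S_def)
  have S1: "1 \<in> S" by (simp add: S_def)
  have fin: "finite S" using S_le by (meson finite_atLeastAtMost finite_subset subsetI)
  have div: "S = {d. d dvd Max S}"
  proof (rule divisor_closed_set_eq_divisors)
    show "d \<in> S" if "e \<in> S" "d dvd e" for d e
      using that unfolding S_def by (auto intro: dvd_trans dvd_power_same)
    show "lcm d e \<in> S" if "d \<in> S" "e \<in> S" for d e
      using that by (simp add: S_def lcm_power_dvd)
  qed (use S1 fin pos in auto)
  have "Max S \<in> S" using fin S1 by (intro Max_in) auto
  then have "Max S > 0" using pos by (cases "Max S = 0") auto
  then have "(\<Sum>d\<in>S. moebius d) = (if Max S = 1 then 1 else 0)"
    using sum_moebius_divisors[of "Max S"] div by simp
  moreover have "Max S = 1 \<longleftrightarrow> (\<forall>d\<in>S. d = 1)"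
    using div \<open>Max S \<in> S\<close> by fastforce
  ultimately show ?thesis unfolding S_eq by (simp add: S_def)
qed

section \<open>The arithmetic criterion for visibility\<close>

text \<open>By Bezout, \<open>t\<close> to the gcd of two exponents is a quotient of powers of the
  two given rationals; induction extends this to finite sets, starting from
  \<open>Gcd {} = 0\<close>.\<close>

lemma Rats_power_Gcd:
  fixes t :: real
  assumes "finite A" "t > 0" "\<And>a. a \<in> A \<Longrightarrow> t ^ a \<in> \<rat>"
  shows "t ^ (Gcd A :: nat) \<in> \<rat>"
  using assms(1,3)
proof (induction A rule: finite_induct)
  case (insert a F)
  define g where "g = Gcd F"
  have a: "t ^ a \<in> \<rat>" and g: "t ^ g \<in> \<rat>"
    using insert by (auto simp: g_def)
  show ?case
  proof (cases "a = 0")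
    case False
    \<comment> \<open>This subtraction-free form of Bezout's identity requires
      \<open>a \<noteq> 0\<close>; for \<open>a = 0\<close> the gcd is just
      \<open>g\<close>.\<close>
    then obtain x y where "a * x = g * y + gcd a g"
      using bezout_nat by blast
    then have "(t ^ a) ^ x = (t ^ g) ^ y * t ^ gcd a g"
      by (metis power_add power_mult)
    then have "t ^ gcd a g = (t ^ a) ^ x / (t ^ g) ^ y"
      using assms(2) by (simp add: field_simps)
    then show ?thesis using a g by (simp add: g_def)
  qed (use g in \<open>simp add: g_def\<close>)
qed simp

text \<open>A common divisor \<open>d \<ge> 2\<close> yields the witness \<open>t = 1 / d\<close>.
  Conversely, any witness \<open>t\<close> is rational because the exponents have gcd 1, and its
  reduced denominator is such a \<open>d\<close>.\<close>

lemma visible_iff: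
  assumes "Gcd (b ` {1..k}) = 1" "\<And>i. i \<in> {1..k} \<Longrightarrow> n i \<ge> 1"
    and "k \<ge> 1" "\<And>i. i \<in> {1..k} \<Longrightarrow> b i \<ge> 1"
  shows "visible k b n \<longleftrightarrow> (\<forall>d. (\<forall>i\<in>{1..k}. d ^ b i dvd n i) \<longrightarrow> d = 1)"
proof (rule iffI)
  assume vis: "visible k b n"
  show "\<forall>d. (\<forall>i\<in>{1..k}. d ^ b i dvd n i) \<longrightarrow> d = 1"
  proof (intro allI impI, rule ccontr)
    fix d assume d: "\<forall>i\<in>{1..k}. d ^ b i dvd n i" "d \<noteq> 1"
    \<comment> \<open>As \<open>b 1 \<ge> 1\<close>, \<open>d = 0\<close> would make 0 divide the
      positive number \<open>n 1\<close>.\<close>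
    have "d \<noteq> 0"
      using d(1) assms(2)[of 1] assms(3) assms(4)[of 1] by (auto simp: zero_power intro!: gr0I dest!: bspec[of _ _ 1])
    then have d2: "d \<ge> 2" using d(2) by simp
    have "real (n i) * (1 / real d) ^ b i \<in> real ` {1..}" if i: "i \<in> {1..k}" for i
    proof -
      obtain c where c: "n i = d ^ b i * c" using d(1) i by blast
      then have "c \<ge> 1" using assms(2)[OF i] by (cases c) auto
      moreover have "real (n i) * (1 / real d) ^ b i = real c"
        using d2 by (simp add: c power_divide)
      ultimately show ?thesis by auto
    qed
    then show False using vis d2 unfolding visible_def
      by (auto dest!: spec[of _ "1 / real d"])
  qed
next
  assume R: "\<forall>d. (\<forall>i\<in>{1..k}. d ^ b i dvd n i) \<longrightarrow> d = 1"
  show "visible k b n"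
    unfolding visible_def
  proof (rule notI, elim exE conjE)
    fix t :: real
    assume t: "0 < t" "t < 1" "\<forall>i\<in>{1..k}. real (n i) * t ^ b i \<in> real ` {1..}"
    have "t ^ b i \<in> \<rat>" if i: "i \<in> {1..k}" for i
    proof -
      obtain m where "real (n i) * t ^ b i = real m" using t(3) i by blast
      then have "t ^ b i = real m / real (n i)" using assms(2)[OF i] by (simp add: field_simps)
      then show ?thesis by simp
    qed
    then have "t \<in> \<rat>"
      using Rats_power_Gcd[of "b ` {1..k}" t] t(1) unfolding assms(1) by fastforce
    then obtain p q where pq: "q \<noteq> 0" "\<bar>t\<bar> = real p / real q" "coprime p q"
      by (rule Rats_abs_nat_div_natE)
    have teq: "t = real p / real q" using pq(2) t(1) by simp
    have "q ^ b i dvd n i" if i: "i \<in> {1..k}" for i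
    proof -
      obtain m where "real (n i) * t ^ b i = real m" using t(3) i by blast
      then have "real (n i * p ^ b i) = real (m * q ^ b i)"
        using pq(1) by (simp add: teq field_simps)
      then have "n i * p ^ b i = m * q ^ b i" by (simp only: of_nat_eq_iff)
      then have "q ^ b i dvd n i * p ^ b i" by simp
      moreover have "coprime (q ^ b i) (p ^ b i)"
        using pq(3) by (simp add: coprime_commute)
      ultimately show ?thesis using coprime_dvd_mult_left_iff by blast
    qed
    \<comment> \<open>With denominator 1, \<open>t\<close> would be an integer strictly between 0
      and 1.\<close>
    then have "q = 1" using R by blast
    then show False using teq t(1,2) by simp
  qed
qed

section \<open>Counting the visible points of a box\<close>

lemma card_multiples:
  assumes "c > 0"
  shows "card {x \<in> {1..N}. c dvd x} = N div c"
proof -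
  have "{x \<in> {1..N}. c dvd x} = (\<lambda>j. c * j) ` {1..N div c}"
  proof (intro equalityI subsetI)
    fix x assume x: "x \<in> {x \<in> {1..N}. c dvd x}"
    then obtain j where j: "x = c * j" by blast
    have "j \<ge> 1" using x j by (cases j) auto
    moreover have "j \<le> N div c"
      using x j assms by (simp add: less_eq_div_iff_mult_less_eq mult.commute)
    ultimately show "x \<in> (\<lambda>j. c * j) ` {1..N div c}" using j by auto
  next
    fix x assume "x \<in> (\<lambda>j. c * j) ` {1..N div c}"
    then show "x \<in> {x \<in> {1..N}. c dvd x}"
      using assms by (auto simp: less_eq_div_iff_mult_less_eq mult.commute)
  qed
  then show ?thesis using assms by (simp add: card_image inj_on_def)
qed

text \<open>The indicator of visibility is replaced by its Moebius sum and the two summations are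
  swapped. For fixed \<open>d\<close> the divisibility conditions are independent across
  coordinates, so the count is a product.\<close>

lemma card_visible:
  assumes "k \<ge> 1" "\<And>i. i \<in> {1..k} \<Longrightarrow> b i \<ge> 1" "Gcd (b ` {1..k}) = 1"
  shows "real (card {n \<in> {1..k} \<rightarrow>\<^sub>E {1..N}. visible k b n})
         = (\<Sum>d=1..N. moebius d * (\<Prod>i=1..k. real (N div d ^ b i)))"
proof -
  let ?B = "{1..k} \<rightarrow>\<^sub>E {1..N}"
  have fin: "finite ?B" by (simp add: finite_PiE)
  have "real (card {n \<in> ?B. visible k b n}) = (\<Sum>n\<in>?B. if visible k b n then 1 else 0)"
    using fin by (simp add: sum.If_cases Int_def)
  also have "\<dots> = (\<Sum>n\<in>?B. \<Sum>d | d \<in> {1..N} \<and> (\<forall>i\<in>{1..k}. d ^ b i dvd n i). moebius d)"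
  proof (rule sum.cong[OF refl])
    fix n assume n: "n \<in> ?B"
    have n1: "n i \<in> {1..N}" if "i \<in> {1..k}" for i using n that by (rule PiE_mem)
    then have n2: "n i \<ge> 1" if "i \<in> {1..k}" for i using that by force
    show "(if visible k b n then 1 else 0)
        = (\<Sum>d | d \<in> {1..N} \<and> (\<forall>i\<in>{1..k}. d ^ b i dvd n i). moebius d)"
      using sum_moebius_power_dvd[of "{1..k}" b n N] n1 assms
        visible_iff[of b k n, OF assms(3) n2 assms(1,2)]
      by simp
  qed
  also have "\<dots> = (\<Sum>d=1..N. \<Sum>n | n \<in> ?B \<and> (\<forall>i\<in>{1..k}. d ^ b i dvd n i). moebius d)"
    using fin by (intro sum.swap_restrict) auto
  also have "\<dots> = (\<Sum>d=1..N. moebius d * (\<Prod>i=1..k. real (N div d ^ b i)))"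
  proof (rule sum.cong[OF refl])
    fix d assume d: "d \<in> {1..N}"
    have "{n \<in> ?B. \<forall>i\<in>{1..k}. d ^ b i dvd n i} = (\<Pi>\<^sub>E i\<in>{1..k}. {x \<in> {1..N}. d ^ b i dvd x})"
      by (auto simp: PiE_iff extensional_def)
    moreover have "card {x \<in> {1..N}. d ^ b i dvd x} = N div d ^ b i" for i
      using d by (intro card_multiples) simp
    ultimately have "card {n \<in> ?B. \<forall>i\<in>{1..k}. d ^ b i dvd n i} = (\<Prod>i=1..k. N div d ^ b i)"
      by (simp only: card_PiE finite_atLeastAtMost)
    then show "(\<Sum>n | n \<in> ?B \<and> (\<forall>i\<in>{1..k}. d ^ b i dvd n i). moebius d)
             = moebius d * (\<Prod>i=1..k. real (N div d ^ b i))"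
      by simp
  qed
  finally show ?thesis .
qed

section \<open>Limits and Dirichlet series\<close>

lemma div_over_tendsto:
  assumes "c > 0"
  shows "(\<lambda>N. real (N div c) / real N) \<longlonglongrightarrow> 1 / real c"
proof (rule tendsto_sandwich)
  show "\<forall>\<^sub>F N in sequentially. 1 / real c - 1 / real N \<le> real (N div c) / real N"
    using eventually_gt_at_top[of 0]
  proof eventually_elim
    case (elim N)
    have "real N / real c - 1 \<le> real (N div c)"
    proof -
      have "real N \<le> real (c * (N div c) + c)"
        using dividend_less_times_div[OF assms, of N] by (simp only: of_nat_le_iff)
      then show ?thesis using assms by (simp add: field_simps)
    qed
    then have "(real N / real c - 1) / real N \<le> real (N div c) / real N"
      by (rule divide_right_mono) simp
    then show ?case using elim assms by (simp add: field_simps)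
  qed
  show "\<forall>\<^sub>F N in sequentially. real (N div c) / real N \<le> 1 / real c"
    using eventually_gt_at_top[of 0]
  proof eventually_elim
    case (elim N)
    then show ?case using of_nat_div_le_of_nat[of N c, where 'a = real] assms by (simp add: field_simps)
  qed
  have "(\<lambda>N. 1 / real c - 1 / real N) \<longlonglongrightarrow> 1 / real c - 0"
    by (intro tendsto_diff tendsto_const lim_1_over_n)
  then show "(\<lambda>N. 1 / real c - 1 / real N) \<longlonglongrightarrow> 1 / real c" by simp
qed simp

text \<open>The product is an absolutely convergent double sum over \<open>m\<close> and
  \<open>d\<close>. Grouped by \<open>n = m * d\<close>, its inner sums are divisor sums of
  \<open>moebius\<close>, which vanish except at \<open>n = 1\<close>.\<close>

lemma zeta_times_moebius_series:
  assumes "s \<ge> 2"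
  shows "(\<Sum>j. 1 / real (Suc j) ^ s) * (\<Sum>j. moebius (Suc j) / real (Suc j) ^ s) = 1"
proof -
  define A :: "nat set" where "A = {1..}"
  have summ: "summable (\<lambda>j. 1 / real (Suc j) ^ s)"
    using inverse_power_summable[OF assms, where 'a = real]
    by (subst summable_Suc_iff) (simp add: inverse_eq_divide)
  \<comment> \<open>Passing to unordered sums over the positive integers permits free rearrangement
    later on.\<close>
  have reindex: "infsum g A = (\<Sum>\<^sub>\<infinity>j. g (Suc j))" "g summable_on A \<longleftrightarrow> (\<lambda>j. g (Suc j)) summable_on UNIV"
    for g :: "nat \<Rightarrow> real"
  proof -
    have bij: "bij_betw Suc UNIV A"
      unfolding A_def bij_betw_def by (auto simp: image_iff Suc_le_eq gr0_conv_Suc)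
    show "infsum g A = (\<Sum>\<^sub>\<infinity>j. g (Suc j))" "g summable_on A \<longleftrightarrow> (\<lambda>j. g (Suc j)) summable_on UNIV"
      using infsum_reindex_bij_betw[OF bij, of g] summable_on_reindex_bij_betw[OF bij, of g] by simp_all
  qed
  have abs1: "(\<lambda>n. 1 / real n ^ s) summable_on A"
    unfolding reindex(2) by (rule norm_summable_imp_summable_on) (use summ in simp)
  have bound: "norm (moebius n / real n ^ s) \<le> 1 / real n ^ s" for n
    using abs_moebius_le[of n] by (simp add: divide_right_mono)
  have summ_mu: "summable (\<lambda>j. norm (moebius (Suc j) / real (Suc j) ^ s))"
    by (rule summable_comparison_test'[OF summ]) (use bound in \<open>simp del: of_nat_Suc\<close>)
  have abs2: "(\<lambda>n. norm (moebius n / real n ^ s)) summable_on A"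
    unfolding reindex(2) by (rule norm_summable_imp_summable_on) (use summ_mu in simp)
  have Z: "(\<Sum>\<^sub>\<infinity>n\<in>A. 1 / real n ^ s) = (\<Sum>j. 1 / real (Suc j) ^ s)"
    unfolding reindex(1)
    by (rule infsumI[OF norm_summable_imp_has_sum[OF _ summable_sums[OF summ]]]) (use summ in simp)
  have M: "(\<Sum>\<^sub>\<infinity>n\<in>A. moebius n / real n ^ s) = (\<Sum>j. moebius (Suc j) / real (Suc j) ^ s)"
    unfolding reindex(1)
    by (rule infsumI[OF norm_summable_imp_has_sum[OF summ_mu summable_sums[OF summable_norm_cancel[OF summ_mu]]]])

  define F where "F = (\<lambda>(m, d). (1 / real m ^ s) * (moebius d / real d ^ s))"
  have "F abs_summable_on A \<times> A"
    unfolding abs_summable_on_Sigma_iff F_def prod.case norm_mult infsum_cmult_right'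
      real_norm_def[of "infsum _ _"]
    using abs1 abs2 by (auto simp: abs_mult intro!: summable_on_cmult_right summable_on_cmult_left
        simp del: times_divide_eq_left times_divide_eq_right divide_divide_eq_left)
  then have F: "F summable_on A \<times> A" by (rule abs_summable_summable)
  have "infsum F (A \<times> A) = (\<Sum>\<^sub>\<infinity>m\<in>A. \<Sum>\<^sub>\<infinity>d\<in>A. F (m, d))"
    using infsum_Sigma_banach[OF F] by simp
  also have "\<dots> = (\<Sum>\<^sub>\<infinity>n\<in>A. 1 / real n ^ s) * (\<Sum>\<^sub>\<infinity>n\<in>A. moebius n / real n ^ s)"
    unfolding F_def prod.case infsum_cmult_right' infsum_cmult_left' ..
  finally have prod: "infsum F (A \<times> A)
    = (\<Sum>j. 1 / real (Suc j) ^ s) * (\<Sum>j. moebius (Suc j) / real (Suc j) ^ s)"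
    by (simp only: Z M)

  \<comment> \<open>\<open>G\<close> is the summand \<open>F\<close> in the coordinates
    \<open>n = m * d\<close> and \<open>d\<close>; the pairs that occur are exactly those with
    \<open>d dvd n\<close>.\<close>
  define G where "G = (\<lambda>(n, d). moebius d / real n ^ s)"
  have bij: "bij_betw (\<lambda>(m, d). (m * d, d)) (A \<times> A) (SIGMA n:A. {d. d dvd n})"
    by (rule bij_betwI[where g = "\<lambda>(n, d). (n div d, d)"])
      (auto simp: A_def Suc_le_eq dvd_pos_nat intro: dvd_imp_le simp: div_greater_zero_iff)
  have FG: "F = (\<lambda>x. G (case x of (m, d) \<Rightarrow> (m * d, d)))"
    by (auto simp: F_def G_def fun_eq_iff power_mult_distrib)
  have G: "G summable_on (SIGMA n:A. {d. d dvd n})"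
    using F summable_on_reindex_bij_betw[OF bij, of G] by (simp add: FG)
  have "infsum F (A \<times> A) = infsum G (SIGMA n:A. {d. d dvd n})"
    using infsum_reindex_bij_betw[OF bij, of G] by (simp add: FG)
  also have "\<dots> = (\<Sum>\<^sub>\<infinity>n\<in>A. \<Sum>\<^sub>\<infinity>d\<in>{d. d dvd n}. G (n, d))"
    using infsum_Sigma_banach[OF G] by simp
  also have "\<dots> = (\<Sum>\<^sub>\<infinity>n\<in>A. if n = 1 then 1 else 0)"
  proof (rule infsum_cong)
    fix n assume "n \<in> A"
    then have n: "n > 0" by (simp add: A_def)
    then have "(\<Sum>\<^sub>\<infinity>d\<in>{d. d dvd n}. G (n, d)) = (\<Sum>d | d dvd n. moebius d) / real n ^ s"
      by (simp add: G_def sum_divide_distrib)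
    also have "\<dots> = (if n = 1 then 1 else 0)"
      unfolding sum_moebius_divisors[OF n] by simp
    finally show "(\<Sum>\<^sub>\<infinity>d\<in>{d. d dvd n}. G (n, d)) = (if n = 1 then 1 else 0)" .
  qed
  also have "\<dots> = (\<Sum>\<^sub>\<infinity>n\<in>{1::nat}. 1)"
    by (rule infsum_cong_neutral) (auto simp: A_def)
  finally show ?thesis using prod by simp
qed

text \<open>Links the real exponent in \<open>zeta\<close> to the natural exponents of the series
  above.\<close>

lemma zeta_of_nat: "zeta (real s) = (\<Sum>j. 1 / real (Suc j) ^ s)"
  unfolding zeta_def by (simp add: powr_minus powr_realpow inverse_eq_divide)

section \<open>Passage to the limit\<close>

theorem theorem1:
  fixes k :: nat and b :: "nat \<Rightarrow> nat"
  assumes "k \<ge> 1"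
    and "\<And>i. i \<in> {1..k} \<Longrightarrow> b i \<ge> 1"
    and "Gcd (b ` {1..k}) = 1"
  shows "(\<lambda>N::nat. real (card {n \<in> {1..k} \<rightarrow>\<^sub>E {1..N}. visible k b n}) / real N ^ k)
           \<longlonglongrightarrow> inverse_zeta (real (\<Sum>i=1..k. b i))"
proof -
  define s where "s = (\<Sum>i=1..k. b i)"
  \<comment> \<open>Separates the cases: \<open>s = 1\<close> forces \<open>k = 1\<close> and
    \<open>b 1 = 1\<close>, and otherwise \<open>s \<ge> 2\<close>, where the series
    converge.\<close>
  have ks: "k \<le> s" using sum_mono[of "{1..k}" "\<lambda>_. 1" b] assms(2) by (simp add: s_def)
  show ?thesis
  proof (cases "s = 1")
    case True
    then have k: "k = 1" using assms(1) ks by simp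
    then have b: "b 1 = 1" using True by (simp add: s_def)
    have count: "real (card {n \<in> {1..k} \<rightarrow>\<^sub>E {1..N}. visible k b n}) = 1" if N: "N > 0" for N
    proof -
      have "{n \<in> {1..k} \<rightarrow>\<^sub>E {1..N}. visible k b n} = {1..k} \<rightarrow>\<^sub>E {1}"
      proof (intro equalityI subsetI)
        fix n assume n: "n \<in> {n \<in> {1..k} \<rightarrow>\<^sub>E {1..N}. visible k b n}"
        then have nN: "n i \<ge> 1" if "i \<in> {1..k}" for i using that by (force simp: PiE_iff)
        \<comment> \<open>Here \<open>d = n 1\<close> is itself admissible in the visibility
          criterion.\<close>
        have "n 1 = 1"
          using n visible_iff[of b k n, OF assms(3) nN assms(1,2)] k b by auto
        then show "n \<in> {1..k} \<rightarrow>\<^sub>E {1}" using n k by (auto simp: PiE_iff extensional_def)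
      next
        fix n assume n: "n \<in> {1..k} \<rightarrow>\<^sub>E {1::nat}"
        then have nN: "n i \<ge> 1" if "i \<in> {1..k}" for i using that by (force simp: PiE_iff)
        show "n \<in> {n \<in> {1..k} \<rightarrow>\<^sub>E {1..N}. visible k b n}"
          using n visible_iff[of b k n, OF assms(3) nN assms(1,2)] k b N by (auto simp: PiE_iff)
      qed
      then show ?thesis by (simp add: card_PiE)
    qed
    have "(\<lambda>N. 1 / real N) \<longlonglongrightarrow> 0" by (rule lim_1_over_n)
    moreover have "\<forall>\<^sub>F N in sequentially. 1 / real N
        = real (card {n \<in> {1..k} \<rightarrow>\<^sub>E {1..N}. visible k b n}) / real N ^ k"
      using eventually_gt_at_top[of 0] by eventually_elim (simp only: count, simp add: k)
    ultimately show ?thesis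
      using True by (auto simp: inverse_zeta_def s_def intro: Lim_transform_eventually)
  next
    case False
    then have s2: "s \<ge> 2" using ks assms(1) by simp
    \<comment> \<open>The factors of \<open>N ^ k\<close> are distributed over the \<open>k\<close>
      coordinates; the shift to \<open>Suc j\<close> makes the series run over the positive
      integers.\<close>
    define a where "a = (\<lambda>j N. moebius (Suc j) * (\<Prod>i=1..k. real (N div Suc j ^ b i) / real N))"
    have s_prod: "(\<Prod>i=1..k. 1 / real (c ^ b i)) = 1 / real c ^ s" for c
      by (simp add: s_def power_sum prod_dividef)
    have summ: "summable (\<lambda>j. 1 / real (Suc j) ^ s)"
      using inverse_power_summable[OF s2, where 'a = real]
      by (subst summable_Suc_iff) (simp add: inverse_eq_divide)
    have lim: "(\<lambda>N. a j N) \<longlonglongrightarrow> moebius (Suc j) / real (Suc j) ^ s" for j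
    proof -
      have "(\<lambda>N. a j N) \<longlonglongrightarrow> moebius (Suc j) * (\<Prod>i=1..k. 1 / real (Suc j ^ b i))"
        unfolding a_def by (intro tendsto_mult tendsto_const tendsto_prod div_over_tendsto) simp
      then show ?thesis unfolding s_prod by simp
    qed
    \<comment> \<open>The majorant is independent of \<open>N\<close>, as Tannery's theorem demands;
      at \<open>N = 0\<close> the quotients are 0 by the convention for division by zero.\<close>
    have bound: "norm (a j N) \<le> 1 / real (Suc j) ^ s" for j N
    proof -
      have "real (N div Suc j ^ b i) / real N \<le> 1 / real (Suc j ^ b i)" for i
        using of_nat_div_le_of_nat[of N "Suc j ^ b i", where 'a = real]
        by (cases "N = 0") (simp_all add: field_simps del: of_nat_Suc)
      then have "(\<Prod>i=1..k. real (N div Suc j ^ b i) / real N) \<le> 1 / real (Suc j) ^ s"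
        unfolding s_prod[symmetric] by (intro prod_mono) auto
      then have "\<bar>moebius (Suc j)\<bar> * (\<Prod>i=1..k. real (N div Suc j ^ b i) / real N)
          \<le> 1 * (1 / real (Suc j) ^ s)"
        using abs_moebius_le by (intro mult_mono) (auto intro: prod_nonneg)
      then show ?thesis by (simp add: a_def abs_mult abs_prod)
    qed
    have "(\<lambda>N. \<Sum>j. a j N) \<longlonglongrightarrow> (\<Sum>j. moebius (Suc j) / real (Suc j) ^ s)"
      using tannerys_theorem[OF lim _ summ] bound by (simp add: case_prod_unfold)
    moreover have "(\<Sum>j. a j N)
        = real (card {n \<in> {1..k} \<rightarrow>\<^sub>E {1..N}. visible k b n}) / real N ^ k" for N
    proof -
      \<comment> \<open>For \<open>j \<ge> N\<close> the factor at coordinate 1 vanishes, since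
        \<open>Suc j ^ b 1 > N\<close>; the series is therefore a finite sum.\<close>
      have "a j N = 0" if "j \<notin> {..<N}" for j
      proof -
        have "Suc j ^ 1 \<le> Suc j ^ b 1" using assms(1,2) by (intro power_increasing) auto
        then have "N div Suc j ^ b 1 = 0" using that by (intro div_less) simp
        then have "\<exists>i\<in>{1..k}. N div Suc j ^ b i = 0" using assms(1) by (intro bexI[of _ 1]) auto
        then show ?thesis by (auto simp: a_def)
      qed
      then have "(\<Sum>j. a j N) = (\<Sum>j<N. a j N)" by (intro suminf_finite) auto
      also have "\<dots> = (\<Sum>d=1..N. moebius d * (\<Prod>i=1..k. real (N div d ^ b i) / real N))"
        unfolding a_def by (rule sum.reindex_bij_witness[of _ "\<lambda>d. d - 1" Suc]) auto
      also have "\<dots> = real (card {n \<in> {1..k} \<rightarrow>\<^sub>E {1..N}. visible k b n}) / real N ^ k"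
        using card_visible[OF assms, of N]
        by (simp only: sum_divide_distrib prod_dividef prod_constant card_atLeastAtMost
            times_divide_eq_right diff_Suc_1 Suc_eq_plus1[symmetric])
      finally show ?thesis .
    qed
    \<comment> \<open>Since its product with the zeta series is 1, the Moebius series is the
      reciprocal; \<open>s \<noteq> 1\<close> selects the ordinary branch of
      \<open>inverse_zeta\<close>.\<close>
    moreover have "(\<Sum>j. moebius (Suc j) / real (Suc j) ^ s) = inverse_zeta (real s)"
      using inverse_unique[OF zeta_times_moebius_series[OF s2]] False
      by (simp add: inverse_zeta_def zeta_of_nat inverse_eq_divide)
    ultimately show ?thesis by (simp add: s_def)
  qed
qed

end
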